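(* Let $\alpha,\beta\in(0,1)$. For any error allocation $\gamma\in(0,1)$, the DP-SPRT $(\tau,\hat d)$ (defined in the context) is $(\alpha,\beta)$-correct, i.e. $\mathbb{P}_{\theta_0}(\hat d=1)\le\alpha$ and $\mathbb{P}_{\theta_1}(\hat d=0)\le\beta$, provided the noises and the correction function $C$ satisfy $$\forall\delta\in(0,1),\quad\sum_{n=1}^\infty\mathbb{P}\left(\frac{Y_n}{n}-\frac{Z}{n}>C(n,\delta)\right)\le\delta,\qquad(\mathrm{a})$$ $$\forall\delta\in(0,1),\quad\sum_{n=1}^\infty\mathbb{P}\left(\frac{Y_n}{n}+\frac{Z}{n}<-C(n,\delta)\right)\le\delta.\qquad(\mathrm{b})$$ In particular, if the distribution $\mathcal{D}_Y$ is symmetric around zero, then condition (a) alone is sufficient, as it implies condition (b).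
   Context: $(\nu_\theta)_{\theta\in\Theta}$, $\Theta\subseteq\mathbb{R}$, is a one-dimensional canonical exponential family: $\nu_\theta$ has density $f_\theta(x)=\exp(\theta x-b(\theta))$ with respect to a fixed reference measure, $b$ being the log-partition function (convex, twice differentiable). Fix $\theta_0<\theta_1$ in $\Theta$; $\mu_i$ is the mean of $\nu_{\theta_i}$ and $\mathrm{KL}$ is the Kullback–Leibler divergence. Under $\mathbb{P}_\theta$ the observations $X_1,X_2,\dots$ are i.i.d. with law $\nu_\theta$. The hypotheses tested are $\mathcal{H}_0:\theta=\theta_0$ and $\mathcal{H}_1:\theta=\theta_1$. DP-SPRT: given noise distributions $\mathcal{D}_Y,\mathcal{D}_Z$ on $\mathbb{R}$, a correction function $C(n,\delta)$ and $\gamma\in(0,1)$, sample $Z\sim\mathcal{D}_Z$ once and $Y_1,Y_2,\dots$ i.i.d. from $\mathcal{D}_Y$, all independent of each other and of the data. With $\bar X_n=\frac1n\sum_{i=1}^nX_i$ and $$\tilde\ell_0^n=\mu_0+\frac{\mathrm{KL}(\nu_{\theta_0},\nu_{\theta_1})-\frac{\log(1/(\gamma\beta))}{n}}{\theta_1-\theta_0}-C(n,(1-\gamma)\beta),\qquad\tilde\ell_1^n=\mu_1-\frac{\mathrm{KL}(\nu_{\theta_1},\nu_{\theta_0})-\frac{\log(1/(\gamma\alpha))}{n}}{\theta_1-\theta_0}+C(n,(1-\gamma)\alpha),$$ set $\tau_0=\inf\{n\ge1:\bar X_n+\frac{Y_n}{n}\le\tilde\ell_0^n-\frac Zn\}$,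 $\tau_1=\inf\{n\ge1:\bar X_n+\frac{Y_n}{n}\ge\tilde\ell_1^n+\frac Zn\}$, $\tau=\min(\tau_0,\tau_1)$, and (when $\tau<\infty$) $\hat d=i$ if $\tau=\tau_i$ (the condition for $i=0$ is checked first, so ties give $\hat d=0$). *)

theory Defs
  imports "HOL-Probability.Probability"
begin

definition natural_space :: "real measure \<Rightarrow> real set" where
  "natural_space \<rho> = {\<theta>. integrable \<rho> (\<lambda>x. exp (\<theta> * x))}"

text \<open>Meaningful on \<^const>\<open>natural_space\<close> only.\<close>

definition log_partition :: "real measure \<Rightarrow> real \<Rightarrow> real" where
  "log_partition \<rho> \<theta> = ln (\<integral>x. exp (\<theta> * x) \<partial>\<rho>)"

definition expfam :: "real measure \<Rightarrow> real \<Rightarrow> real measure" where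
  "expfam \<rho> \<theta> = density \<rho> (\<lambda>x. ennreal (exp (\<theta> * x - log_partition \<rho> \<theta>)))"

text \<open>
  The first derivative is taken within the natural parameter space, so that it is the ordinary
  derivative at interior points and one-sided at end points belonging to \<open>\<Theta>\<close>.
  Convexity of the log-partition function is not assumed: it is the lemma
  \<open>convex_log_partition\<close> below.
  Sigma-finiteness of \<open>\<rho>\<close> follows from integrability of a positive function.
\<close>

locale canonical_exponential_family =
  fixes \<rho> :: "real measure" and \<Theta> :: "real set"
  assumes sets_ref: "sets \<rho> = sets borel"
    and ref_nonzero: "emeasure \<rho> (space \<rho>) \<noteq> 0"
    and params: "\<Theta> \<subseteq> natural_space \<rho>"
    and twice_differentiable:
      "\<exists>b' b''. \<forall>\<theta>\<in>\<Theta>.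
         (log_partition \<rho> has_real_derivative b' \<theta>) (at \<theta> within natural_space \<rho>) \<and>
         (b' has_real_derivative b'' \<theta>) (at \<theta> within \<Theta>)"
begin

lemma measurable_exp_ref: "(\<lambda>x. exp (\<theta> * x + c)) \<in> borel_measurable \<rho>" for \<theta> c :: real
  by (simp add: measurable_cong_sets[OF sets_ref refl])

lemma partition_eq:
  assumes "\<theta> \<in> natural_space \<rho>"
  shows "(\<integral>\<^sup>+x. ennreal (exp (\<theta> * x)) \<partial>\<rho>) = ennreal (exp (log_partition \<rho> \<theta>))"
proof -
  have int: "integrable \<rho> (\<lambda>x. exp (\<theta> * x))"
    using assms by (simp add: natural_space_def)
  have "\<not> (AE x in \<rho>. exp (\<theta> * x) = 0)"
  proof
    assume "AE x in \<rho>. exp (\<theta> * x) = 0"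
    then have "AE x in \<rho>. False" by simp
    then show False
      using ref_nonzero by (simp add: eventually_False ae_filter_eq_bot_iff)
  qed
  then have "(\<integral>x. exp (\<theta> * x) \<partial>\<rho>) \<noteq> 0"
    using integral_nonneg_eq_0_iff_AE[OF int] by simp
  moreover have "(\<integral>x. exp (\<theta> * x) \<partial>\<rho>) \<ge> 0"
    by (rule integral_nonneg_AE) simp
  ultimately have "(\<integral>x. exp (\<theta> * x) \<partial>\<rho>) > 0"
    by (simp only: less_le not_sym simp_thms)
  then have "(\<integral>x. exp (\<theta> * x) \<partial>\<rho>) = exp (log_partition \<rho> \<theta>)"
    by (simp only: log_partition_def exp_ln)
  then show ?thesis
    using nn_integral_eq_integral[OF int] by simp
qed

lemma prob_space_expfam:
  assumes "\<theta> \<in> natural_space \<rho>"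
  shows "prob_space (expfam \<rho> \<theta>)"
proof
  have "emeasure (expfam \<rho> \<theta>) (space (expfam \<rho> \<theta>)) =
      (\<integral>\<^sup>+x. ennreal (exp (- log_partition \<rho> \<theta>)) * ennreal (exp (\<theta> * x)) \<partial>\<rho>)"
    using measurable_exp_ref[of \<theta> "- log_partition \<rho> \<theta>"]
    by (simp add: expfam_def emeasure_density mult.commute
        flip: ennreal_mult exp_add cong: nn_integral_cong)
  also have "\<dots> = ennreal (exp (- log_partition \<rho> \<theta>)) * ennreal (exp (log_partition \<rho> \<theta>))"
    using measurable_exp_ref[of \<theta> 0] by (simp add: nn_integral_cmult partition_eq[OF assms])
  also have "\<dots> = 1"
    by (simp flip: ennreal_mult exp_add)
  finally show "emeasure (expfam \<rho> \<theta>) (space (expfam \<rho> \<theta>)) = 1" .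
qed

lemma convex_log_partition: "convex_on (natural_space \<rho>) (log_partition \<rho>)"
proof -
  have main: "u * s + v * t \<in> natural_space \<rho> \<and>
      log_partition \<rho> (u * s + v * t) \<le> u * log_partition \<rho> s + v * log_partition \<rho> t"
    if s: "s \<in> natural_space \<rho>" and t: "t \<in> natural_space \<rho>"
      and u: "u \<ge> 0" and v: "v \<ge> 0" and uv: "u + v = 1" for s t u v
  proof -
    let ?b = "log_partition \<rho>"
    define w where "w = u * s + v * t"
    define c where "c = u * ?b s + v * ?b t"
    have young: "exp (w * x - c) \<le> u * exp (s * x - ?b s) + v * exp (t * x - ?b t)" for x
    proof -
      have "exp (u *\<^sub>R (s * x - ?b s) + v *\<^sub>R (t * x - ?b t))
          \<le> u * exp (s * x - ?b s) + v * exp (t * x - ?b t)"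
        using exp_convex u v uv unfolding convex_on_def by blast
      then show ?thesis by (simp add: w_def c_def algebra_simps)
    qed
    have pt: "exp (w * x) \<le> exp c * (u * (exp (- ?b s) * exp (s * x)) + v * (exp (- ?b t) * exp (t * x)))"
      for x
      using mult_left_mono[OF young[of x], of "exp c"]
      by (simp add: mult_exp_exp)
    have js: "integrable \<rho> (\<lambda>x. exp (s * x))" and jt: "integrable \<rho> (\<lambda>x. exp (t * x))"
      using s t by (simp_all add: natural_space_def)
    have int: "integrable \<rho>
        (\<lambda>x. exp c * (u * (exp (- ?b s) * exp (s * x)) + v * (exp (- ?b t) * exp (t * x))))"
      by (intro integrable_mult_right Bochner_Integration.integrable_add js jt)
    have iw: "integrable \<rho> (\<lambda>x. exp (w * x))"
      using measurable_exp_ref[of w 0] pt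
      by (intro Bochner_Integration.integrable_bound[OF int]) (auto intro: order_trans[OF _ abs_ge_self])
    then have w: "w \<in> natural_space \<rho>" by (simp add: natural_space_def)
    have ex: "(\<integral>x. exp (r * x) \<partial>\<rho>) = exp (?b r)" if "r \<in> natural_space \<rho>" for r
      using partition_eq[OF that] nn_integral_eq_integral[of \<rho> "\<lambda>x. exp (r * x)"] that
      by (simp add: natural_space_def)
    have "exp (?b w) = (\<integral>x. exp (w * x) \<partial>\<rho>)" by (simp add: ex[OF w])
    also have "\<dots> \<le> (\<integral>x. exp c * (u * (exp (- ?b s) * exp (s * x)) + v * (exp (- ?b t) * exp (t * x))) \<partial>\<rho>)"
      by (intro integral_mono iw int pt)
    also have "\<dots> = exp c * (u * (exp (- ?b s) * exp (?b s)) + v * (exp (- ?b t) * exp (?b t)))"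
      using js jt by (simp add: ex[OF s] ex[OF t])
    also have "\<dots> = exp c" by (simp add: mult_exp_exp uv)
    finally show ?thesis using w by (simp add: w_def c_def)
  qed
  then show ?thesis
    unfolding convex_on_def convex_def by auto
qed

end

text \<open>
  The library's \<^term>\<open>KL_divergence b M N\<close> is the divergence of \<open>N\<close> from \<open>M\<close>, in base \<open>b\<close>,
  so the arguments are swapped here.
\<close>

definition KL :: "real measure \<Rightarrow> real measure \<Rightarrow> real" where
  "KL P Q = KL_divergence (exp 1) Q P"

definition mean :: "real measure \<Rightarrow> real" where
  "mean P = (\<integral>x. x \<partial>P)"

text \<open>
  One sample space carries data and noise, with one measure \<open>P \<theta>\<close> per parameter; the noise laws do
  not depend on \<open>\<theta>\<close>. Sequences are indexed from 1 (the values at 0 are unconstrained).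
\<close>

locale dp_sprt_model = canonical_exponential_family \<rho> \<Theta>
  for \<rho> :: "real measure" and \<Theta> :: "real set" +
  fixes DY DZ :: "real measure"
    and P :: "real \<Rightarrow> 'a measure"
    and X Y :: "nat \<Rightarrow> 'a \<Rightarrow> real" and Z :: "'a \<Rightarrow> real"
  assumes noise_laws: "real_distribution DY" "real_distribution DZ"
    and prob_space_P: "\<theta> \<in> \<Theta> \<Longrightarrow> prob_space (P \<theta>)"
    and distr_X: "\<theta> \<in> \<Theta> \<Longrightarrow> n \<ge> 1 \<Longrightarrow> distr (P \<theta>) borel (X n) = expfam \<rho> \<theta>"
    and distr_Y: "\<theta> \<in> \<Theta> \<Longrightarrow> n \<ge> 1 \<Longrightarrow> distr (P \<theta>) borel (Y n) = DY"
    and distr_Z: "\<theta> \<in> \<Theta> \<Longrightarrow> distr (P \<theta>) borel Z = DZ"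
    and indep: "\<theta> \<in> \<Theta> \<Longrightarrow>
      prob_space.indep_vars (P \<theta>) (\<lambda>_. borel)
        (case_sum X (case_sum Y (\<lambda>_. Z))) ({1..} <+> ({1..} <+> {()}))"

definition threshold0 ::
  "real measure \<Rightarrow> real \<Rightarrow> real \<Rightarrow> (nat \<Rightarrow> real \<Rightarrow> real) \<Rightarrow> real \<Rightarrow> real \<Rightarrow> nat \<Rightarrow> real" where
  "threshold0 \<rho> \<theta>0 \<theta>1 C \<gamma> \<beta> n =
     mean (expfam \<rho> \<theta>0)
     + (KL (expfam \<rho> \<theta>0) (expfam \<rho> \<theta>1) - ln (1 / (\<gamma> * \<beta>)) / real n) / (\<theta>1 - \<theta>0)
     - C n ((1 - \<gamma>) * \<beta>)"

definition threshold1 ::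
  "real measure \<Rightarrow> real \<Rightarrow> real \<Rightarrow> (nat \<Rightarrow> real \<Rightarrow> real) \<Rightarrow> real \<Rightarrow> real \<Rightarrow> nat \<Rightarrow> real" where
  "threshold1 \<rho> \<theta>0 \<theta>1 C \<gamma> \<alpha> n =
     mean (expfam \<rho> \<theta>1)
     - (KL (expfam \<rho> \<theta>1) (expfam \<rho> \<theta>0) - ln (1 / (\<gamma> * \<alpha>)) / real n) / (\<theta>1 - \<theta>0)
     + C n ((1 - \<gamma>) * \<alpha>)"

definition sample_mean :: "(nat \<Rightarrow> 'a \<Rightarrow> real) \<Rightarrow> nat \<Rightarrow> 'a \<Rightarrow> real" where
  "sample_mean X n \<omega> = (\<Sum>i=1..n. X i \<omega>) / real n"

text \<open>In \<^typ>\<open>enat\<close> the infimum of the empty set is \<open>\<infinity>\<close>.\<close>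

definition tau0 ::
  "(nat \<Rightarrow> real) \<Rightarrow> (nat \<Rightarrow> 'a \<Rightarrow> real) \<Rightarrow> (nat \<Rightarrow> 'a \<Rightarrow> real) \<Rightarrow> ('a \<Rightarrow> real) \<Rightarrow> 'a \<Rightarrow> enat" where
  "tau0 l0 X Y Z \<omega> =
     Inf (enat ` {n. n \<ge> 1 \<and> sample_mean X n \<omega> + Y n \<omega> / real n \<le> l0 n - Z \<omega> / real n})"

definition tau1 ::
  "(nat \<Rightarrow> real) \<Rightarrow> (nat \<Rightarrow> 'a \<Rightarrow> real) \<Rightarrow> (nat \<Rightarrow> 'a \<Rightarrow> real) \<Rightarrow> ('a \<Rightarrow> real) \<Rightarrow> 'a \<Rightarrow> enat" where
  "tau1 l1 X Y Z \<omega> =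
     Inf (enat ` {n. n \<ge> 1 \<and> sample_mean X n \<omega> + Y n \<omega> / real n \<ge> l1 n + Z \<omega> / real n})"

text \<open>\<^const>\<open>None\<close>: the test never stops.\<close>

definition decision ::
  "(nat \<Rightarrow> real) \<Rightarrow> (nat \<Rightarrow> real) \<Rightarrow> (nat \<Rightarrow> 'a \<Rightarrow> real) \<Rightarrow> (nat \<Rightarrow> 'a \<Rightarrow> real) \<Rightarrow> ('a \<Rightarrow> real) \<Rightarrow>
    'a \<Rightarrow> nat option" where
  "decision l0 l1 X Y Z \<omega> =
     (let \<tau> = min (tau0 l0 X Y Z \<omega>) (tau1 l1 X Y Z \<omega>)
      in if \<tau> = \<infinity> then None
         else if \<tau> = tau0 l0 X Y Z \<omega> then Some 0 else Some 1)"

definition dp_sprt_decision ::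
  "real measure \<Rightarrow> real \<Rightarrow> real \<Rightarrow> (nat \<Rightarrow> real \<Rightarrow> real) \<Rightarrow> real \<Rightarrow> real \<Rightarrow> real \<Rightarrow>
    (nat \<Rightarrow> 'a \<Rightarrow> real) \<Rightarrow> (nat \<Rightarrow> 'a \<Rightarrow> real) \<Rightarrow> ('a \<Rightarrow> real) \<Rightarrow> 'a \<Rightarrow> nat option" where
  "dp_sprt_decision \<rho> \<theta>0 \<theta>1 C \<gamma> \<alpha> \<beta> X Y Z =
     decision (threshold0 \<rho> \<theta>0 \<theta>1 C \<gamma> \<beta>) (threshold1 \<rho> \<theta>0 \<theta>1 C \<gamma> \<alpha>) X Y Z"

definition correct_test ::
  "(real \<Rightarrow> 'a measure) \<Rightarrow> real \<Rightarrow> real \<Rightarrow> real \<Rightarrow> real \<Rightarrow> ('a \<Rightarrow> nat option) \<Rightarrow> bool" where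
  "correct_test P \<theta>0 \<theta>1 \<alpha> \<beta> d \<longleftrightarrow>
     measure (P \<theta>0) {\<omega> \<in> space (P \<theta>0). d \<omega> = Some 1} \<le> \<alpha> \<and>
     measure (P \<theta>1) {\<omega> \<in> space (P \<theta>1). d \<omega> = Some 0} \<le> \<beta>"

text \<open>
  The noise conditions involve only the joint law \<open>DY \<Otimes> DZ\<close> of each pair of independent noises.
  The series are taken in \<^typ>\<open>ennreal\<close>, so that the bound entails convergence, and are shifted
  to start at 1.
\<close>

definition noise_condition_a ::
  "real measure \<Rightarrow> real measure \<Rightarrow> (nat \<Rightarrow> real \<Rightarrow> real) \<Rightarrow> bool" where
  "noise_condition_a DY DZ C \<longleftrightarrow>
     (\<forall>\<delta>\<in>{0<..<1}.
        (\<Sum>n. emeasure (DY \<Otimes>\<^sub>M DZ)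
           {(y, z). y / real (Suc n) - z / real (Suc n) > C (Suc n) \<delta>}) \<le> ennreal \<delta>)"

definition noise_condition_b ::
  "real measure \<Rightarrow> real measure \<Rightarrow> (nat \<Rightarrow> real \<Rightarrow> real) \<Rightarrow> bool" where
  "noise_condition_b DY DZ C \<longleftrightarrow>
     (\<forall>\<delta>\<in>{0<..<1}.
        (\<Sum>n. emeasure (DY \<Otimes>\<^sub>M DZ)
           {(y, z). y / real (Suc n) + z / real (Suc n) < - C (Suc n) \<delta>}) \<le> ennreal \<delta>)"

definition symmetric_around_zero :: "real measure \<Rightarrow> bool" where
  "symmetric_around_zero D \<longleftrightarrow> distr D borel uminus = D"

end

theory Submission
  imports Defs
begin

text \<open>
  The likelihood ratios of the i.i.d. data are products of independent nonnegative variables of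
  mean 1, so the probability that they ever reach \<open>1/\<epsilon>\<close> is at most \<open>\<epsilon>\<close>. With \<open>A\<close> the
  log-partition function, the formula \<open>KL(\<nu>\<^sub>a, \<nu>\<^sub>b) = (a - b) \<mu>\<^sub>a - (A(a) - A(b))\<close> turns
  each DP-SPRT stopping condition, once the noise is bounded by the correction \<open>C\<close>, into such a
  crossing with \<open>\<epsilon> = \<gamma>\<alpha>\<close> or \<open>\<epsilon> = \<gamma>\<beta>\<close>; by the noise condition, the noise exceeds the
  correction with probability at most \<open>(1 - \<gamma>)\<alpha>\<close> or \<open>(1 - \<gamma>)\<beta>\<close>. If \<open>\<theta>\<close> is an end point of
  the natural parameter space, existence of the mean is not automatic: it follows from the
  one-sided differentiability by Fatou's lemma.
\<close>

section \<open>A maximal inequality\<close>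

text \<open>
  Freezing the partial products at level \<open>c\<close> does not change their mean, so Markov's inequality at
  a single time bounds the probability that \<open>c\<close> was reached at any earlier time.
\<close>

primrec stopped_prod :: "real \<Rightarrow> (nat \<Rightarrow> real) \<Rightarrow> nat \<Rightarrow> real" where
  "stopped_prod c w 0 = 1"
| "stopped_prod c w (Suc n) =
     (if stopped_prod c w n \<ge> c then stopped_prod c w n else stopped_prod c w n * w (Suc n))"

lemma stopped_prod_nonneg: "(\<And>i. w i \<ge> 0) \<Longrightarrow> stopped_prod c w n \<ge> 0"
  by (induction n) auto

lemma stopped_prod_mono_reached: "c \<le> stopped_prod c w m \<Longrightarrow> m \<le> n \<Longrightarrow> c \<le> stopped_prod c w n"
  by (induction n) (auto simp: le_Suc_eq)

text \<open>A frozen value stays at least \<open>c\<close>, so a value still below \<open>c\<close>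
  at time \<open>n\<close> shows that no factor up to \<open>n\<close> was skipped.\<close>

lemma stopped_prod_eq_prod: "\<not> c \<le> stopped_prod c w n \<Longrightarrow> stopped_prod c w n = (\<Prod>i=1..n. w i)"
  by (induction n) (auto split: if_splits)

lemma stopped_prod_reached:
  assumes "c \<le> (\<Prod>i=1..n. w i)"
  shows "c \<le> stopped_prod c w n"
  using assms stopped_prod_eq_prod[of c w n] by fastforce

lemma stopped_prod_cong: "(\<And>i. 1 \<le> i \<Longrightarrow> i \<le> n \<Longrightarrow> v i = w i) \<Longrightarrow> stopped_prod c v n = stopped_prod c w n"
  by (induction n) auto

lemma measurable_stopped_prod_PiM:
  "{1..n} \<subseteq> J \<Longrightarrow> (\<lambda>f. stopped_prod c f n) \<in> borel_measurable (PiM J (\<lambda>_. borel))"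
proof (induction n)
  case (Suc n)
  then have [measurable]: "(\<lambda>f. stopped_prod c f n) \<in> borel_measurable (PiM J (\<lambda>_. borel))"
    by (auto simp: subset_eq)
  have [measurable]: "(\<lambda>f. f (Suc n)) \<in> borel_measurable (PiM J (\<lambda>_. borel))"
    using Suc.prems by (intro measurable_component_singleton) auto
  show ?case by simp
qed simp

context prob_space
begin

text \<open>The stopped product at time \<open>n\<close> is a function of the variables with index
  in \<open>{1..n}\<close>, a block disjoint from \<open>{Suc n}\<close>; functions of disjoint
  blocks of an independent family are independent.\<close>

lemma indep_stopped_prod:
  fixes W :: "nat \<Rightarrow> 'a \<Rightarrow> real"
  assumes "indep_vars (\<lambda>_. borel) W {1..}"
  shows "indep_var borel (\<lambda>\<omega>. stopped_prod c (\<lambda>i. W i \<omega>) n) borel (W (Suc n))"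
proof -
  have "indep_var
      borel ((\<lambda>f. stopped_prod c f n) \<circ> (\<lambda>\<omega>. restrict (\<lambda>i. W i \<omega>) {1..n}))
      borel ((\<lambda>f. f (Suc n)) \<circ> (\<lambda>\<omega>. restrict (\<lambda>i. W i \<omega>) {Suc n}))"
    by (rule indep_var_compose[OF indep_var_restrict[OF assms]])
       (auto intro: measurable_stopped_prod_PiM measurable_component_singleton)
  moreover have "stopped_prod c (restrict (\<lambda>i. W i \<omega>) {1..n}) n = stopped_prod c (\<lambda>i. W i \<omega>) n" for \<omega>
    by (rule stopped_prod_cong) auto
  ultimately show ?thesis by (simp add: comp_def)
qed

lemma stopped_prod_expectation:
  fixes W :: "nat \<Rightarrow> 'a \<Rightarrow> real"
  assumes indep: "indep_vars (\<lambda>_. borel) W {1..}"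
    and int: "\<And>i. i \<ge> 1 \<Longrightarrow> integrable M (W i)"
    and mean_1: "\<And>i. i \<ge> 1 \<Longrightarrow> expectation (W i) = 1"
  shows "integrable M (\<lambda>\<omega>. stopped_prod c (\<lambda>i. W i \<omega>) n) \<and>
         expectation (\<lambda>\<omega>. stopped_prod c (\<lambda>i. W i \<omega>) n) = 1"
proof (induction n)
  case 0
  show ?case by (simp add: prob_space)
next
  case (Suc n)
  let ?V = "\<lambda>\<omega>. stopped_prod c (\<lambda>i. W i \<omega>) n"
  define A where "A \<omega> = (if ?V \<omega> \<ge> c then ?V \<omega> else 0)" for \<omega>
  define B where "B \<omega> = (if ?V \<omega> \<ge> c then 0 else ?V \<omega>)" for \<omega>
  have V: "integrable M ?V" "expectation ?V = 1" using Suc by auto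
  note [measurable] = borel_measurable_integrable[OF V(1)]
  have A: "integrable M A" and B: "integrable M B"
    unfolding A_def B_def by (auto intro!: Bochner_Integration.integrable_bound[OF V(1)])
  have "indep_var borel ((\<lambda>v. if v \<ge> c then 0 else v) \<circ> ?V) borel (id \<circ> W (Suc n))"
    by (rule indep_var_compose[OF indep_stopped_prod[OF indep]]) auto
  then have BW: "indep_var borel B borel (W (Suc n))"
    by (simp add: comp_def B_def[abs_def])
  note iBW = indep_var_integrable[OF BW B int] indep_var_lebesgue_integral[OF BW B int]
  have eq: "stopped_prod c (\<lambda>i. W i \<omega>) (Suc n) = A \<omega> + B \<omega> * W (Suc n) \<omega>" for \<omega>
    by (simp add: A_def B_def)
  have "expectation A + expectation B = expectation ?V"
    by (subst Bochner_Integration.integral_add[OF A B, symmetric])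
       (auto intro!: Bochner_Integration.integral_cong simp: A_def B_def)
  then show ?case
    unfolding eq using A B V iBW mean_1[of "Suc n"] by simp
qed

lemma prod_maximal_inequality:
  fixes W :: "nat \<Rightarrow> 'a \<Rightarrow> real"
  assumes indep: "indep_vars (\<lambda>_. borel) W {1..}"
    and int: "\<And>i. i \<ge> 1 \<Longrightarrow> integrable M (W i)"
    and mean_1: "\<And>i. i \<ge> 1 \<Longrightarrow> expectation (W i) = 1"
    and nonneg: "\<And>i \<omega>. W i \<omega> \<ge> 0"
    and c: "c > 0"
  shows "prob {\<omega> \<in> space M. \<exists>n\<ge>1. c \<le> (\<Prod>i=1..n. W i \<omega>)} \<le> 1 / c"
proof -
  define S where "S n = {\<omega> \<in> space M. c \<le> stopped_prod c (\<lambda>i. W i \<omega>) n}" for n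
  note E = stopped_prod_expectation[OF indep int mean_1]
  have [measurable]: "(\<lambda>\<omega>. stopped_prod c (\<lambda>i. W i \<omega>) n) \<in> borel_measurable M" for n
    using E by (blast intro: borel_measurable_integrable)
  have S: "S n \<in> events" for n unfolding S_def by measurable
  have "prob (S n) \<le> expectation (\<lambda>\<omega>. stopped_prod c (\<lambda>i. W i \<omega>) n) / c" for n
    unfolding S_def using E c
    by (intro integral_Markov_inequality_measure[where A="{}"]) (auto intro: stopped_prod_nonneg nonneg)
  then have le: "prob (S n) \<le> 1 / c" for n using E by simp
  \<comment> \<open>Freezing makes the events \<open>S n\<close> increase, so the bound that
    Markov's inequality gives at each single time passes to their union, which contains every
    crossing.\<close>
  have "incseq S"
    unfolding S_def by (auto intro!: monoI intro: stopped_prod_mono_reached)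
  then have "(\<lambda>n. prob (S n)) \<longlonglongrightarrow> prob (\<Union>n. S n)"
    using S by (intro finite_Lim_measure_incseq) auto
  then have "prob (\<Union>n. S n) \<le> 1 / c"
    using le by (intro LIMSEQ_le_const2) auto
  moreover have "prob {\<omega> \<in> space M. \<exists>n\<ge>1. c \<le> (\<Prod>i=1..n. W i \<omega>)} \<le> prob (\<Union>n. S n)"
  proof (rule finite_measure_mono)
    show "{\<omega> \<in> space M. \<exists>n\<ge>1. c \<le> (\<Prod>i=1..n. W i \<omega>)} \<subseteq> (\<Union>n. S n)"
      unfolding S_def using stopped_prod_reached by blast
  qed (use S in auto)
  ultimately show ?thesis by linarith
qed

end

section \<open>Mean and divergence in the exponential family\<close>

text \<open>Convexity of \<open>exp\<close> at the point \<open>s * u\<close> between 0 and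
  \<open>u\<close>. It gives the sign that Fatou's lemma needs when the mean is shown to
  exist.\<close>

lemma exp_secant_mono:
  fixes u s :: real
  assumes "0 < s" "s \<le> 1"
  shows "(exp (s * u) - 1) / s \<le> exp u - 1"
proof -
  have "exp ((1 - s) *\<^sub>R 0 + s *\<^sub>R u) \<le> (1 - s) * exp 0 + s * exp u"
    by (rule convex_onD[OF exp_convex]) (use assms in auto)
  then show ?thesis using assms by (simp add: field_simps)
qed

context canonical_exponential_family
begin

lemma exp_log_partition:
  assumes "r \<in> natural_space \<rho>"
  shows "exp (log_partition \<rho> r) = (\<integral>x. exp (r * x) \<partial>\<rho>)"
  using partition_eq[OF assms] nn_integral_eq_integral[of \<rho> "\<lambda>x. exp (r * x)"] assms
  by (simp add: natural_space_def)

text \<open>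
  As \<open>s\<close> decreases to 0, the secant slopes of \<open>s \<mapsto> exp ((\<theta> + s d) x)\<close> over \<open>[0, s]\<close> decrease
  to the derivative \<open>d x exp (\<theta> x)\<close>, and their integrals converge since the
  log-partition function is differentiable within the segment.
\<close>

lemma integrable_mean:
  assumes \<theta>: "\<theta> \<in> \<Theta>" and \<eta>: "\<eta> \<in> natural_space \<rho>" and ne: "\<theta> \<noteq> \<eta>"
  shows "integrable \<rho> (\<lambda>x. x * exp (\<theta> * x))"
proof -
  define d where "d = \<eta> - \<theta>"
  define s where "s n = inverse (real (Suc n))" for n
  define F where "F r = (\<integral>x. exp (r * x) \<partial>\<rho>)" for r
  have d: "d \<noteq> 0" using ne by (simp add: d_def)
  have s: "0 < s n" "s n \<le> 1" for n by (auto simp: s_def divide_simps)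
  have s0: "s \<longlonglongrightarrow> 0" unfolding s_def by (rule LIMSEQ_inverse_real_of_nat)
  have \<theta>N: "\<theta> \<in> natural_space \<rho>" using \<theta> params by auto
  \<comment> \<open>The natural parameter space is convex, so the whole segment from \<theta> to
    \<eta> can be used even if \<theta> is an end point.\<close>
  have seg: "\<theta> + s n * d \<in> natural_space \<rho>" for n
  proof -
    have "(1 - s n) *\<^sub>R \<theta> + s n *\<^sub>R \<eta> \<in> natural_space \<rho>"
      using convex_log_partition s[of n] \<theta>N \<eta> by (intro convexD) (auto simp: convex_on_def)
    then show ?thesis by (simp add: d_def algebra_simps)
  qed
  have int: "integrable \<rho> (\<lambda>x. exp (r * x))" if "r \<in> natural_space \<rho>" for r
    using that by (simp add: natural_space_def)
  obtain D where "(log_partition \<rho> has_real_derivative D) (at \<theta> within natural_space \<rho>)"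
    using twice_differentiable \<theta> by blast
  then have "((\<lambda>r. exp (log_partition \<rho> r)) has_real_derivative exp (log_partition \<rho> \<theta>) * D)
      (at \<theta> within natural_space \<rho>)"
    by (auto intro!: derivative_eq_intros)
  then obtain L where L: "((\<lambda>r. exp (log_partition \<rho> r)) has_real_derivative L) (at \<theta> within natural_space \<rho>)"
    by blast
  have "((\<lambda>r. (exp (log_partition \<rho> r) - exp (log_partition \<rho> \<theta>)) / (r - \<theta>)) \<longlongrightarrow> L)
      (at \<theta> within natural_space \<rho>)"
    using L by (simp add: has_field_derivative_iff)
  \<comment> \<open>The difference quotient within the natural parameter space may be evaluated
    along this sequence: it stays in that space, tends to \<theta> and never equals
    \<theta>.\<close>
  moreover have "filterlim (\<lambda>n. \<theta> + s n * d) (at \<theta> within natural_space \<rho>) sequentially"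
  proof -
    have "(\<lambda>n. \<theta> + s n * d) \<longlonglongrightarrow> \<theta> + 0 * d" by (intro tendsto_intros s0)
    moreover have "\<theta> + s n * d \<noteq> \<theta>" for n using d s(1)[of n] by simp
    ultimately show ?thesis using seg by (auto simp: filterlim_at)
  qed
  ultimately have "(\<lambda>n. (exp (log_partition \<rho> (\<theta> + s n * d)) - exp (log_partition \<rho> \<theta>)) / (\<theta> + s n * d - \<theta>)) \<longlonglongrightarrow> L"
    by (rule filterlim_compose)
  then have "(\<lambda>n. (F (\<theta> + s n * d) - F \<theta>) / (s n * d)) \<longlonglongrightarrow> L"
    by (simp add: exp_log_partition[OF seg] exp_log_partition[OF \<theta>N] F_def)
  then have "(\<lambda>n. F \<eta> - F \<theta> - (F (\<theta> + s n * d) - F \<theta>) / (s n * d) * d) \<longlonglongrightarrow> F \<eta> - F \<theta> - L * d"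
    by (intro tendsto_intros)
  then have lim: "(\<lambda>n. F \<eta> - F \<theta> - (F (\<theta> + s n * d) - F \<theta>) / s n) \<longlonglongrightarrow> F \<eta> - F \<theta> - L * d"
    using d by simp
  \<comment> \<open>The integrand \<open>x * exp (\<theta> * x)\<close> has no fixed sign.
    Subtracting the secant slope over \<open>[0, s n]\<close> from the one over
    \<open>[0, 1]\<close> gives a nonnegative function by convexity, with pointwise limit
    \<open>H\<close>, to which Fatou's lemma applies.\<close>
  define G where "G n x = exp (\<eta> * x) - exp (\<theta> * x) - (exp ((\<theta> + s n * d) * x) - exp (\<theta> * x)) / s n" for n x
  define H where "H x = exp (\<eta> * x) - exp (\<theta> * x) - d * (x * exp (\<theta> * x))" for x
  have G_nonneg: "G n x \<ge> 0" for n x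
  proof -
    have "G n x = exp (\<theta> * x) * (exp (d * x) - 1 - (exp (s n * (d * x)) - 1) / s n)"
      using s(1)[of n] by (simp add: G_def d_def field_simps flip: exp_add)
    then show ?thesis using exp_secant_mono[OF s(1,2), of n "d * x"] by simp
  qed
  have G_int: "integrable \<rho> (G n)" "integral\<^sup>L \<rho> (G n) = F \<eta> - F \<theta> - (F (\<theta> + s n * d) - F \<theta>) / s n" for n
    unfolding G_def F_def using int[OF \<theta>N] int[OF \<eta>] int[OF seg[of n]] by auto
  have G_lim: "(\<lambda>n. G n x) \<longlonglongrightarrow> H x" for x
  proof -
    have "((\<lambda>r. exp ((\<theta> + r * d) * x)) has_real_derivative d * (x * exp (\<theta> * x))) (at 0)"
      by (auto intro!: derivative_eq_intros)
    then have "((\<lambda>r. (exp ((\<theta> + r * d) * x) - exp (\<theta> * x)) / r) \<longlongrightarrow> d * (x * exp (\<theta> * x))) (at 0)"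
      by (simp add: has_field_derivative_iff)
    moreover have "filterlim s (at 0) sequentially"
      using s0 s(1) by (auto simp: filterlim_at less_imp_neq[symmetric])
    ultimately have "(\<lambda>n. (exp ((\<theta> + s n * d) * x) - exp (\<theta> * x)) / s n) \<longlonglongrightarrow> d * (x * exp (\<theta> * x))"
      by (rule filterlim_compose)
    then show ?thesis unfolding G_def H_def by (intro tendsto_intros)
  qed
  have H_nonneg: "H x \<ge> 0" for x
    by (rule LIMSEQ_le_const[OF G_lim]) (use G_nonneg in auto)
  have H_meas: "H \<in> borel_measurable \<rho>"
    by (rule borel_measurable_LIMSEQ_real[OF G_lim]) (use G_int in auto)
  have "(\<integral>\<^sup>+x. ennreal (H x) \<partial>\<rho>) = (\<integral>\<^sup>+x. liminf (\<lambda>n. ennreal (G n x)) \<partial>\<rho>)"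
    using G_lim by (intro nn_integral_cong lim_imp_Liminf[symmetric]) auto
  also have "\<dots> \<le> liminf (\<lambda>n. \<integral>\<^sup>+x. ennreal (G n x) \<partial>\<rho>)"
    using G_int by (intro nn_integral_liminf) auto
  also have "\<dots> = liminf (\<lambda>n. ennreal (F \<eta> - F \<theta> - (F (\<theta> + s n * d) - F \<theta>) / s n))"
    using G_nonneg by (simp add: nn_integral_eq_integral[OF G_int(1)] G_int(2))
  also have "\<dots> = ennreal (F \<eta> - F \<theta> - L * d)"
    using lim by (intro lim_imp_Liminf) auto
  finally have "(\<integral>\<^sup>+x. ennreal (H x) \<partial>\<rho>) < \<infinity>"
    using ennreal_less_top le_less_trans by fastforce
  then have "integrable \<rho> H"
    using H_nonneg H_meas by (intro integrableI_nonneg) auto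
  \<comment> \<open>Solving the definition of \<open>H\<close> for
    \<open>x * exp (\<theta> * x)\<close> expresses it through integrable functions, since
    \<open>d\<close> is nonzero.\<close>
  then have "integrable \<rho> (\<lambda>x. (exp (\<eta> * x) - exp (\<theta> * x) - H x) / d)"
    using int[OF \<theta>N] int[OF \<eta>] by auto
  then show ?thesis using d by (simp add: H_def)
qed

section \<open>Likelihood ratios and divergence between members of the family\<close>

lemma expfam_eq_density:
  "expfam \<rho> b =
     density (expfam \<rho> a) (\<lambda>x. ennreal (exp ((b - a) * x - (log_partition \<rho> b - log_partition \<rho> a))))"
proof -
  show ?thesis
    unfolding expfam_def
    by (subst density_density_eq)
       (auto intro!: density_cong simp: measurable_cong_sets[OF sets_ref refl] algebra_simps
          simp flip: ennreal_mult exp_add)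
qed

lemma sets_expfam [measurable_cong]: "sets (expfam \<rho> a) = sets borel"
  by (simp add: expfam_def sets_ref)

text \<open>The integral is the total mass of \<open>expfam \<rho> b\<close>, written as a density
  with respect to \<open>expfam \<rho> a\<close>. It provides the factors of mean 1 for the maximal
  inequality.\<close>

lemma likelihood_ratio_integral:
  assumes "b \<in> natural_space \<rho>"
  shows "(\<integral>\<^sup>+x. ennreal (exp ((b - a) * x - (log_partition \<rho> b - log_partition \<rho> a))) \<partial>expfam \<rho> a) = 1"
proof -
  interpret prob_space "expfam \<rho> b" by (rule prob_space_expfam[OF assms])
  have [measurable]: "(\<lambda>x. exp ((b - a) * x - (log_partition \<rho> b - log_partition \<rho> a)))
      \<in> borel_measurable (expfam \<rho> a)"
    by (simp add: measurable_cong_sets[OF sets_expfam refl])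
  have "1 = emeasure (expfam \<rho> b) (space (expfam \<rho> b))" by (simp add: emeasure_space_1)
  also have "\<dots> = (\<integral>\<^sup>+x. ennreal (exp ((b - a) * x - (log_partition \<rho> b - log_partition \<rho> a))) \<partial>expfam \<rho> a)"
    by (subst (1 2) expfam_eq_density[of b a])
       (auto simp: emeasure_density intro!: nn_integral_cong)
  finally show ?thesis by simp
qed

text \<open>The logarithm \<open>g\<close> of the likelihood ratio is affine in \<open>x\<close>, so
  its integral involves the law only through the mean.\<close>

lemma KL_expfam:
  assumes a: "a \<in> \<Theta>" and b: "b \<in> natural_space \<rho>" and ne: "a \<noteq> b"
  shows "KL (expfam \<rho> a) (expfam \<rho> b) =
    (a - b) * mean (expfam \<rho> a) - (log_partition \<rho> a - log_partition \<rho> b)"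
proof -
  have aN: "a \<in> natural_space \<rho>" using a params by auto
  interpret A: prob_space "expfam \<rho> a" by (rule prob_space_expfam[OF aN])
  interpret B: prob_space "expfam \<rho> b" by (rule prob_space_expfam[OF b])
  define g where "g x = (a - b) * x - (log_partition \<rho> a - log_partition \<rho> b)" for x
  have g [measurable]: "g \<in> borel_measurable borel" unfolding g_def by measurable
  have eq: "expfam \<rho> a = density (expfam \<rho> b) (\<lambda>x. ennreal (exp (g x)))"
    unfolding g_def by (rule expfam_eq_density)
  \<comment> \<open>Integrability of the identity lets the integral of \<open>g\<close> split;
    without it \<open>mean\<close> would only be the default value 0 of the Bochner
    integral.\<close>
  have "integrable \<rho> (\<lambda>x. exp (- log_partition \<rho> a) * (x * exp (a * x)))"
    by (intro integrable_mult_right integrable_mean[OF a b ne])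
  also have "(\<lambda>x. exp (- log_partition \<rho> a) * (x * exp (a * x))) =
      (\<lambda>x. exp (a * x - log_partition \<rho> a) *\<^sub>R x)"
    by (auto simp: fun_eq_iff mult_ac exp_diff exp_minus divide_inverse)
  finally have int: "integrable (expfam \<rho> a) (\<lambda>x. x)"
    unfolding expfam_def using measurable_exp_ref[of a "- log_partition \<rho> a"]
    by (subst integrable_density) (auto simp: measurable_cong_sets[OF sets_ref refl])
  have "KL (expfam \<rho> a) (expfam \<rho> b) = (\<integral>x. exp (g x) * log (exp 1) (exp (g x)) \<partial>expfam \<rho> b)"
    unfolding KL_def by (subst eq, rule B.KL_density) auto
  also have "\<dots> = (\<integral>x. exp (g x) *\<^sub>R g x \<partial>expfam \<rho> b)"
    by (simp add: log_def)
  also have "\<dots> = (\<integral>x. g x \<partial>expfam \<rho> a)"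
    by (subst eq, subst integral_density) auto
  also have "\<dots> = (a - b) * mean (expfam \<rho> a) - (log_partition \<rho> a - log_partition \<rho> b)"
    unfolding g_def mean_def using int A.prob_space by simp
  finally show ?thesis .
qed

end

section \<open>Error probabilities of the test\<close>

context dp_sprt_model
begin

text \<open>The data form singleton blocks of the joint index set of data and noise; relabelling
  these blocks by \<open>n\<close> preserves independence.\<close>

lemma indep_X: "\<theta> \<in> \<Theta> \<Longrightarrow> prob_space.indep_vars (P \<theta>) (\<lambda>_. borel) X {1..}"
proof -
  assume \<theta>: "\<theta> \<in> \<Theta>"
  interpret prob_space "P \<theta>" by (rule prob_space_P[OF \<theta>])
  let ?F = "case_sum X (case_sum Y (\<lambda>_::unit. Z))"
  have "indep_vars (\<lambda>n. PiM {Inl n} (\<lambda>_. borel)) (\<lambda>n \<omega>. restrict (\<lambda>i. ?F i \<omega>) {Inl n}) {1..}"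
    by (rule indep_vars_restrict[OF indep[OF \<theta>]]) (auto simp: disjoint_family_on_def)
  then have "indep_vars (\<lambda>_. borel) (\<lambda>n \<omega>. restrict (\<lambda>i. ?F i \<omega>) {Inl n} (Inl n)) {1..}"
    by (rule indep_vars_compose2) (auto intro: measurable_component_singleton)
  then show ?thesis by simp
qed

lemma random_variables:
  assumes "\<theta> \<in> \<Theta>"
  shows "n \<ge> 1 \<Longrightarrow> X n \<in> borel_measurable (P \<theta>)" "n \<ge> 1 \<Longrightarrow> Y n \<in> borel_measurable (P \<theta>)"
    "Z \<in> borel_measurable (P \<theta>)"
proof -
  interpret prob_space "P \<theta>" by (rule prob_space_P[OF assms])
  have rv: "random_variable borel (case_sum X (case_sum Y (\<lambda>_. Z)) i)"
    if "i \<in> {1..} <+> ({1..} <+> {()})" for i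
    using indep[OF assms] that unfolding indep_vars_def2 by blast
  show "n \<ge> 1 \<Longrightarrow> X n \<in> borel_measurable (P \<theta>)" using rv[of "Inl n"] by auto
  show "n \<ge> 1 \<Longrightarrow> Y n \<in> borel_measurable (P \<theta>)" using rv[of "Inr (Inl n)"] by auto
  show "Z \<in> borel_measurable (P \<theta>)" using rv[of "Inr (Inr ())"] by auto
qed

text \<open>The right-hand side of the inequality is the logarithm of a product of \<open>n\<close>
  independent likelihood ratios of \<open>b\<close> against \<open>a\<close>, each of mean 1 under
  \<open>P a\<close>. The maximal inequality at level \<open>1 / \<epsilon>\<close> then
  applies.\<close>

lemma likelihood_ratio_bound:
  assumes a: "a \<in> \<Theta>" and b: "b \<in> natural_space \<rho>" and \<epsilon>: "\<epsilon> > 0"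
  shows "measure (P a) {\<omega> \<in> space (P a). \<exists>n\<ge>1.
      ln (1 / \<epsilon>) \<le> (b - a) * (\<Sum>i=1..n. X i \<omega>) - real n * (log_partition \<rho> b - log_partition \<rho> a)} \<le> \<epsilon>"
proof -
  interpret prob_space "P a" by (rule prob_space_P[OF a])
  define f where "f x = exp ((b - a) * x - (log_partition \<rho> b - log_partition \<rho> a))" for x
  have f [measurable]: "f \<in> borel_measurable borel" unfolding f_def by measurable
  have f_nonneg: "f x \<ge> 0" for x by (simp add: f_def)
  have nn: "(\<integral>\<^sup>+\<omega>. ennreal (f (X i \<omega>)) \<partial>P a) = 1" if "i \<ge> 1" for i
  proof -
    have "(\<integral>\<^sup>+\<omega>. ennreal (f (X i \<omega>)) \<partial>P a) = (\<integral>\<^sup>+x. ennreal (f x) \<partial>distr (P a) borel (X i))"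
      using random_variables(1)[OF a that] by (intro nn_integral_distr[symmetric]) auto
    then show ?thesis
      using likelihood_ratio_integral[OF b] by (simp add: distr_X[OF a that] f_def)
  qed
  have meas: "(\<lambda>\<omega>. f (X i \<omega>)) \<in> borel_measurable (P a)" if "i \<ge> 1" for i
    using random_variables(1)[OF a that] by measurable
  have "prob {\<omega> \<in> space (P a). \<exists>n\<ge>1. 1 / \<epsilon> \<le> (\<Prod>i=1..n. f (X i \<omega>))} \<le> 1 / (1 / \<epsilon>)"
  proof (rule prod_maximal_inequality)
    show "indep_vars (\<lambda>_. borel) (\<lambda>i \<omega>. f (X i \<omega>)) {1..}"
      by (rule indep_vars_compose2[OF indep_X[OF a]]) auto
    show "integrable (P a) (\<lambda>\<omega>. f (X i \<omega>))" if "i \<ge> 1" for i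
      using nn[OF that] meas[OF that] f_nonneg by (intro integrableI_nonneg) auto
    show "expectation (\<lambda>\<omega>. f (X i \<omega>)) = 1" if "i \<ge> 1" for i
      using nn[OF that] meas[OF that] f_nonneg by (subst integral_eq_nn_integral) auto
  qed (use \<epsilon> f_nonneg in auto)
  moreover have "1 / \<epsilon> \<le> (\<Prod>i=1..n. f (X i \<omega>)) \<longleftrightarrow>
      ln (1 / \<epsilon>) \<le> (b - a) * (\<Sum>i=1..n. X i \<omega>) - real n * (log_partition \<rho> b - log_partition \<rho> a)" for n \<omega>
  proof -
    have "(\<Prod>i=1..n. f (X i \<omega>)) =
        exp ((b - a) * (\<Sum>i=1..n. X i \<omega>) - real n * (log_partition \<rho> b - log_partition \<rho> a))"
      by (simp add: f_def exp_sum[symmetric] sum_subtractf sum_distrib_left)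
    then show ?thesis using \<epsilon> by (metis exp_gt_zero ln_exp ln_le_cancel_iff zero_less_divide_1_iff)
  qed
  ultimately show ?thesis by simp
qed

section \<open>The joint law of the noise pairs and the union bound over time\<close>

lemma sets_noise_exceeds:
  fixes c :: real
  shows "{(y, z). y / real n - z / real n > c} \<in> sets (borel \<Otimes>\<^sub>M borel)"
    and "{(y, z). y / real n + z / real n < c} \<in> sets (borel \<Otimes>\<^sub>M borel)"
proof -
  have "{p \<in> space (borel \<Otimes>\<^sub>M borel). fst p / real n - snd p / real n > c} \<in> sets (borel \<Otimes>\<^sub>M borel)"
    by measurable
  also have "{p \<in> space (borel \<Otimes>\<^sub>M borel). fst p / real n - snd p / real n > c} =
      {(y, z). y / real n - z / real n > c}"
    by (auto simp: space_pair_measure)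
  finally show "{(y, z). y / real n - z / real n > c} \<in> sets (borel \<Otimes>\<^sub>M borel)" .
  have "{p \<in> space (borel \<Otimes>\<^sub>M borel). fst p / real n + snd p / real n < c} \<in> sets (borel \<Otimes>\<^sub>M borel)"
    by measurable
  also have "{p \<in> space (borel \<Otimes>\<^sub>M borel). fst p / real n + snd p / real n < c} =
      {(y, z). y / real n + z / real n < c}"
    by (auto simp: space_pair_measure)
  finally show "{(y, z). y / real n + z / real n < c} \<in> sets (borel \<Otimes>\<^sub>M borel)" .
qed

lemma sets_noise: "sets (DY \<Otimes>\<^sub>M DZ) = sets (borel \<Otimes>\<^sub>M borel)"
proof -
  interpret DY: real_distribution DY by (rule noise_laws)
  interpret DZ: real_distribution DZ by (rule noise_laws)
  show ?thesis by (intro sets_pair_measure_cong) auto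
qed

lemma distr_noise:
  assumes \<theta>: "\<theta> \<in> \<Theta>" and n: "n \<ge> 1"
  shows "distr (P \<theta>) (borel \<Otimes>\<^sub>M borel) (\<lambda>\<omega>. (Y n \<omega>, Z \<omega>)) = DY \<Otimes>\<^sub>M DZ"
proof -
  interpret prob_space "P \<theta>" by (rule prob_space_P[OF \<theta>])
  let ?F = "case_sum X (case_sum Y (\<lambda>_::unit. Z))"
  have "indep_var borel ((\<lambda>f. f (Inr (Inl n))) \<circ> (\<lambda>\<omega>. restrict (\<lambda>i. ?F i \<omega>) {Inr (Inl n)}))
      borel ((\<lambda>f. f (Inr (Inr ()))) \<circ> (\<lambda>\<omega>. restrict (\<lambda>i. ?F i \<omega>) {Inr (Inr ())}))"
    by (rule indep_var_compose[OF indep_var_restrict[OF indep[OF \<theta>]]])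
       (use n in \<open>auto intro: measurable_component_singleton\<close>)
  then have "indep_var borel (Y n) borel Z" by (simp add: comp_def)
  then show ?thesis
    by (simp add: indep_var_distribution_eq distr_Y[OF \<theta> n] distr_Z[OF \<theta>])
qed

text \<open>The same \<open>Z\<close> enters at every time, so the events for different
  \<open>n\<close> are dependent; the union bound uses only the law of each pair
  \<open>(Y n, Z)\<close>.\<close>

lemma noise_bound:
  assumes \<theta>: "\<theta> \<in> \<Theta>" and S: "\<And>n. S n \<in> sets (borel \<Otimes>\<^sub>M borel)"
    and sum: "(\<Sum>n. emeasure (DY \<Otimes>\<^sub>M DZ) (S (Suc n))) \<le> ennreal \<delta>" and \<delta>: "\<delta> \<ge> 0"
  shows "measure (P \<theta>) {\<omega> \<in> space (P \<theta>). \<exists>n\<ge>1. (Y n \<omega>, Z \<omega>) \<in> S n} \<le> \<delta>"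
    and "{\<omega> \<in> space (P \<theta>). \<exists>n\<ge>1. (Y n \<omega>, Z \<omega>) \<in> S n} \<in> sets (P \<theta>)"
proof -
  interpret prob_space "P \<theta>" by (rule prob_space_P[OF \<theta>])
  \<comment> \<open>The series runs from 0, so \<open>E n\<close> is the event belonging to time
    \<open>Suc n\<close>.\<close>
  define E where "E n = (\<lambda>\<omega>. (Y (Suc n) \<omega>, Z \<omega>)) -` S (Suc n) \<inter> space (P \<theta>)" for n
  have pair: "(\<lambda>\<omega>. (Y (Suc n) \<omega>, Z \<omega>)) \<in> measurable (P \<theta>) (borel \<Otimes>\<^sub>M borel)" for n
    using random_variables[OF \<theta>] by (intro measurable_Pair) auto
  have E: "E n \<in> events" for n
    unfolding E_def using measurable_sets[OF pair S] .
  have "emeasure (P \<theta>) (E n) = emeasure (DY \<Otimes>\<^sub>M DZ) (S (Suc n))" for n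
    unfolding E_def distr_noise[OF \<theta>, of "Suc n", symmetric, simplified]
    by (rule emeasure_distr[OF pair S, symmetric])
  moreover have "emeasure (P \<theta>) (\<Union>n. E n) \<le> (\<Sum>n. emeasure (P \<theta>) (E n))"
    using E by (intro emeasure_subadditive_countably) auto
  ultimately have "emeasure (P \<theta>) (\<Union>n. E n) \<le> ennreal \<delta>" using sum by simp
  then have le: "prob (\<Union>n. E n) \<le> \<delta>"
    using \<delta> by (simp add: emeasure_eq_measure)
  have eq: "{\<omega> \<in> space (P \<theta>). \<exists>n\<ge>1. (Y n \<omega>, Z \<omega>) \<in> S n} = (\<Union>n. E n)"
  proof -
    have "(\<exists>n\<ge>1. Q n) \<longleftrightarrow> (\<exists>n. Q (Suc n))" for Q
      by (metis One_nat_def Suc_le_D le_add1 plus_1_eq_Suc)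
    then show ?thesis by (auto simp: E_def)
  qed
  show "measure (P \<theta>) {\<omega> \<in> space (P \<theta>). \<exists>n\<ge>1. (Y n \<omega>, Z \<omega>) \<in> S n} \<le> \<delta>" using le eq by simp
  show "{\<omega> \<in> space (P \<theta>). \<exists>n\<ge>1. (Y n \<omega>, Z \<omega>) \<in> S n} \<in> sets (P \<theta>)" using E eq by auto
qed

text \<open>Both error probabilities are instances: \<open>a\<close> is the true parameter,
  \<open>b\<close> the other one, and \<open>A\<close> the event of a wrong decision. This event is
  covered by a crossing of the likelihood ratio and an excess of the noise, with budgets \<epsilon>
  and \<delta>.\<close>

lemma error_bound:
  assumes a: "a \<in> \<Theta>" and b: "b \<in> natural_space \<rho>" and \<epsilon>: "0 < \<epsilon>" and \<delta>: "0 \<le> \<delta>"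
    and S: "\<And>n. S n \<in> sets (borel \<Otimes>\<^sub>M borel)"
    and sum: "(\<Sum>n. emeasure (DY \<Otimes>\<^sub>M DZ) (S (Suc n))) \<le> ennreal \<delta>"
    and cross: "\<And>\<omega>. \<omega> \<in> A \<Longrightarrow> \<exists>n\<ge>1. (Y n \<omega>, Z \<omega>) \<in> S n \<or>
      ln (1 / \<epsilon>) \<le> (b - a) * (\<Sum>i=1..n. X i \<omega>) - real n * (log_partition \<rho> b - log_partition \<rho> a)"
    and A: "A \<subseteq> space (P a)"
  shows "measure (P a) A \<le> \<epsilon> + \<delta>"
proof -
  interpret prob_space "P a" by (rule prob_space_P[OF a])
  let ?L = "{\<omega> \<in> space (P a). \<exists>n\<ge>1.
      ln (1 / \<epsilon>) \<le> (b - a) * (\<Sum>i=1..n. X i \<omega>) - real n * (log_partition \<rho> b - log_partition \<rho> a)}"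
  let ?N = "{\<omega> \<in> space (P a). \<exists>n\<ge>1. (Y n \<omega>, Z \<omega>) \<in> S n}"
  have N: "?N \<in> events" "prob ?N \<le> \<delta>" by (rule noise_bound[where S=S, OF a S sum \<delta>])+
  have [measurable]: "(\<lambda>\<omega>. \<Sum>i=1..n. X i \<omega>) \<in> borel_measurable (P a)" for n
    using random_variables(1)[OF a] by (intro borel_measurable_sum) auto
  have L: "?L \<in> events" by measurable
  have "prob A \<le> prob (?L \<union> ?N)"
    using L N A cross by (intro finite_measure_mono) blast+
  also have "\<dots> \<le> prob ?L + prob ?N"
    using L N by (intro measure_Un_le)
  also have "\<dots> \<le> \<epsilon> + \<delta>"
    using likelihood_ratio_bound[OF a b \<epsilon>] N by linarith
  finally show ?thesis .
qed

text \<open>The map \<open>(y, z) \<mapsto> (- y, z)\<close> preserves the product law when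
  \<open>DY\<close> is symmetric, and it exchanges the events of the two conditions.\<close>

lemma noise_condition_b_if_symmetric:
  assumes sym: "symmetric_around_zero DY" and cond: "noise_condition_a DY DZ C"
  shows "noise_condition_b DY DZ C"
proof -
  interpret DY: real_distribution DY by (rule noise_laws)
  interpret DZ: real_distribution DZ by (rule noise_laws)
  have id: "distr DZ borel (\<lambda>z. z) = DZ" by (intro distr_id2) simp
  have eq: "distr (DY \<Otimes>\<^sub>M DZ) (borel \<Otimes>\<^sub>M borel) (\<lambda>(y, z). (- y, z)) = DY \<Otimes>\<^sub>M DZ"
  proof -
    have "distr DY borel uminus \<Otimes>\<^sub>M distr DZ borel (\<lambda>z. z) =
        distr (DY \<Otimes>\<^sub>M DZ) (borel \<Otimes>\<^sub>M borel) (\<lambda>(y, z). (- y, z))"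
      by (rule pair_measure_distr) (auto simp: id DZ.sigma_finite_measure_axioms)
    then show ?thesis using sym by (simp only: symmetric_around_zero_def id)
  qed
  have "emeasure (DY \<Otimes>\<^sub>M DZ) {(y, z). y / real n + z / real n < - c} =
      emeasure (DY \<Otimes>\<^sub>M DZ) {(y, z). y / real n - z / real n > c}" for n c
  proof -
    have flip: "(\<lambda>(y, z). (- y, z)) \<in> measurable (DY \<Otimes>\<^sub>M DZ) (borel \<Otimes>\<^sub>M borel)"
      by (simp add: measurable_cong_sets[OF sets_noise refl])
    have "emeasure (DY \<Otimes>\<^sub>M DZ) {(y, z). y / real n - z / real n > c} =
        emeasure (DY \<Otimes>\<^sub>M DZ) ((\<lambda>(y, z). (- y, z)) -` {(y, z). y / real n - z / real n > c}
          \<inter> space (DY \<Otimes>\<^sub>M DZ))"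
      by (subst eq[symmetric], rule emeasure_distr[OF flip sets_noise_exceeds(1)])
    also have "(\<lambda>(y, z). (- y, z)) -` {(y, z). y / real n - z / real n > c} \<inter> space (DY \<Otimes>\<^sub>M DZ) =
        {(y, z). y / real n + z / real n < - c}"
      by (auto simp: space_pair_measure)
    finally show ?thesis by simp
  qed
  then show ?thesis using cond by (simp only: noise_condition_a_def noise_condition_b_def)
qed

end

section \<open>From a decision to a threshold crossing\<close>

lemma Inf_enat_neq_infinityD:
  assumes "Inf (enat ` {n. n \<ge> 1 \<and> Q n}) \<noteq> \<infinity>"
  shows "\<exists>n\<ge>1. Q n"
proof (rule ccontr)
  assume "\<not> ?thesis"
  then have "{n. n \<ge> 1 \<and> Q n} = {}" by auto
  then show False using assms by (simp only: image_empty Inf_empty) (simp add: top_enat_def)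
qed

text \<open>The decision 0 forces \<tau> to be finite and equal to \<tau>0. That some time satisfies
  the stopping condition is enough, because the bounds above are uniform in time.\<close>

lemma decision_0D:
  assumes "decision l0 l1 X Y Z \<omega> = Some 0"
  shows "\<exists>n\<ge>1. sample_mean X n \<omega> + Y n \<omega> / real n \<le> l0 n - Z \<omega> / real n"
proof (rule Inf_enat_neq_infinityD)
  show "Inf (enat ` {n. n \<ge> 1 \<and> sample_mean X n \<omega> + Y n \<omega> / real n \<le> l0 n - Z \<omega> / real n}) \<noteq> \<infinity>"
    using assms unfolding tau0_def[symmetric]
    by (auto simp: decision_def Let_def simp del: not_infinity_eq split: if_splits)
qed

text \<open>Here \<tau> is finite and differs from \<tau>0, so the minimum is attained by
  \<tau>1.\<close>

lemma decision_1D: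
  assumes "decision l0 l1 X Y Z \<omega> = Some 1"
  shows "\<exists>n\<ge>1. sample_mean X n \<omega> + Y n \<omega> / real n \<ge> l1 n + Z \<omega> / real n"
proof (rule Inf_enat_neq_infinityD)
  show "Inf (enat ` {n. n \<ge> 1 \<and> sample_mean X n \<omega> + Y n \<omega> / real n \<ge> l1 n + Z \<omega> / real n}) \<noteq> \<infinity>"
    using assms unfolding tau1_def[symmetric]
    by (auto simp: decision_def Let_def min_def split: if_splits)
qed

section \<open>Thresholds through the log-partition function, and correctness of the test\<close>

context dp_sprt_model
begin

text \<open>Inserting the formula for the divergence cancels the mean, leaving a threshold on the
  likelihood ratio shifted by the correction.\<close>

lemma threshold0_eq:
  assumes "\<theta>0 \<in> \<Theta>" "\<theta>1 \<in> \<Theta>" "\<theta>0 < \<theta>1"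
  shows "threshold0 \<rho> \<theta>0 \<theta>1 C \<gamma> \<beta> n =
    (log_partition \<rho> \<theta>1 - log_partition \<rho> \<theta>0 - ln (1 / (\<gamma> * \<beta>)) / real n) / (\<theta>1 - \<theta>0) - C n ((1 - \<gamma>) * \<beta>)"
proof -
  have "KL (expfam \<rho> \<theta>0) (expfam \<rho> \<theta>1) =
      (\<theta>0 - \<theta>1) * mean (expfam \<rho> \<theta>0) - (log_partition \<rho> \<theta>0 - log_partition \<rho> \<theta>1)"
    using assms params by (intro KL_expfam) auto
  moreover have "m + ((\<theta>0 - \<theta>1) * m - (u - v) - w) / (\<theta>1 - \<theta>0) = (v - u - w) / (\<theta>1 - \<theta>0)" for m u v w
    using assms by (simp add: field_simps)
  ultimately show ?thesis by (simp add: threshold0_def)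
qed

lemma threshold1_eq:
  assumes "\<theta>0 \<in> \<Theta>" "\<theta>1 \<in> \<Theta>" "\<theta>0 < \<theta>1"
  shows "threshold1 \<rho> \<theta>0 \<theta>1 C \<gamma> \<alpha> n =
    (log_partition \<rho> \<theta>1 - log_partition \<rho> \<theta>0 + ln (1 / (\<gamma> * \<alpha>)) / real n) / (\<theta>1 - \<theta>0) + C n ((1 - \<gamma>) * \<alpha>)"
proof -
  have "KL (expfam \<rho> \<theta>1) (expfam \<rho> \<theta>0) =
      (\<theta>1 - \<theta>0) * mean (expfam \<rho> \<theta>1) - (log_partition \<rho> \<theta>1 - log_partition \<rho> \<theta>0)"
    using assms params by (intro KL_expfam) auto
  moreover have "m - ((\<theta>1 - \<theta>0) * m - (v - u) - w) / (\<theta>1 - \<theta>0) = (v - u + w) / (\<theta>1 - \<theta>0)" for m u v w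
    using assms by (simp add: field_simps)
  ultimately show ?thesis by (simp add: threshold1_def)
qed

lemma correct_test_dp_sprt:
  assumes \<theta>: "\<theta>0 \<in> \<Theta>" "\<theta>1 \<in> \<Theta>" "\<theta>0 < \<theta>1"
    and err: "\<alpha> \<in> {0<..<1}" "\<beta> \<in> {0<..<1}" "\<gamma> \<in> {0<..<1}"
    and cond: "noise_condition_a DY DZ C" "noise_condition_b DY DZ C"
  shows "correct_test P \<theta>0 \<theta>1 \<alpha> \<beta> (dp_sprt_decision \<rho> \<theta>0 \<theta>1 C \<gamma> \<alpha> \<beta> X Y Z)"
proof -
  let ?d = "dp_sprt_decision \<rho> \<theta>0 \<theta>1 C \<gamma> \<alpha> \<beta> X Y Z"
  let ?B = "log_partition \<rho> \<theta>1 - log_partition \<rho> \<theta>0"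
  have N: "\<theta>0 \<in> natural_space \<rho>" "\<theta>1 \<in> natural_space \<rho>" using \<theta> params by auto
  \<comment> \<open>The noise conditions are applied at level
    \<open>(1 - \<gamma>) * \<delta>\<close>, which must lie in the open unit interval; the
    likelihood ratio receives the remaining budget \<open>\<gamma> * \<delta>\<close>.\<close>
  have split: "(1 - \<gamma>) * \<delta> \<in> {0<..<1}" "\<gamma> * \<delta> + (1 - \<gamma>) * \<delta> = \<delta>" "0 < \<gamma> * \<delta>" if "\<delta> \<in> {0<..<1}" for \<delta>
    using that err(3) mult_strict_mono[of "1 - \<gamma>" 1 \<delta> 1] by (auto simp: algebra_simps)
  have "measure (P \<theta>0) {\<omega> \<in> space (P \<theta>0). ?d \<omega> = Some 1} \<le> \<gamma> * \<alpha> + (1 - \<gamma>) * \<alpha>"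
  proof (rule error_bound[OF \<theta>(1) N(2)])
    let ?S = "\<lambda>n. {(y, z). y / real n - z / real n > C n ((1 - \<gamma>) * \<alpha>)}"
    show "(\<Sum>n. emeasure (DY \<Otimes>\<^sub>M DZ) (?S (Suc n))) \<le> ennreal ((1 - \<gamma>) * \<alpha>)"
      using cond(1) split(1)[OF err(1)] by (simp only: noise_condition_a_def)
    show "?S n \<in> sets (borel \<Otimes>\<^sub>M borel)" for n by (rule sets_noise_exceeds)
    fix \<omega> assume "\<omega> \<in> {\<omega> \<in> space (P \<theta>0). ?d \<omega> = Some 1}"
    then have "decision (threshold0 \<rho> \<theta>0 \<theta>1 C \<gamma> \<beta>) (threshold1 \<rho> \<theta>0 \<theta>1 C \<gamma> \<alpha>) X Y Z \<omega> = Some 1"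
      unfolding dp_sprt_decision_def by blast
    from decision_1D[OF this] obtain n where n: "n \<ge> 1"
      and le: "sample_mean X n \<omega> + Y n \<omega> / real n \<ge> threshold1 \<rho> \<theta>0 \<theta>1 C \<gamma> \<alpha> n + Z \<omega> / real n"
      by blast
    have cancel: "real n * (u + v / real n) = real n * u + v"
      "real n * (u / real n * v) = v * u" for u v :: real
      using n by (auto simp: field_simps)
    have "ln (1 / (\<gamma> * \<alpha>)) \<le> (\<theta>1 - \<theta>0) * (\<Sum>i=1..n. X i \<omega>) - real n * ?B"
      if "(Y n \<omega>, Z \<omega>) \<notin> ?S n"
    proof -
      \<comment> \<open>Outside \<open>?S n\<close> the difference
        \<open>Y n \<omega> / real n - Z \<omega> / real n\<close> is at most the correction
        contained in the threshold, so the sample mean alone passes the noise-free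
        threshold.\<close>
      have "(?B + ln (1 / (\<gamma> * \<alpha>)) / real n) / (\<theta>1 - \<theta>0) \<le> sample_mean X n \<omega>"
        using that le unfolding threshold1_eq[OF \<theta>] mem_Collect_eq prod.case by linarith
      then have "?B + ln (1 / (\<gamma> * \<alpha>)) / real n \<le> (\<Sum>i=1..n. X i \<omega>) / real n * (\<theta>1 - \<theta>0)"
        using \<theta>(3) by (simp only: sample_mean_def pos_divide_le_eq diff_gt_0_iff_gt)
      then have "real n * (?B + ln (1 / (\<gamma> * \<alpha>)) / real n)
          \<le> real n * ((\<Sum>i=1..n. X i \<omega>) / real n * (\<theta>1 - \<theta>0))"
        by (rule mult_left_mono) simp
      then show ?thesis unfolding cancel by (simp add: algebra_simps)
    qed
    then show "\<exists>n\<ge>1. (Y n \<omega>, Z \<omega>) \<in> ?S n \<or>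
        ln (1 / (\<gamma> * \<alpha>)) \<le> (\<theta>1 - \<theta>0) * (\<Sum>i=1..n. X i \<omega>) - real n * ?B"
      using n by blast
  qed (use split[OF err(1)] in auto)
  moreover have "measure (P \<theta>1) {\<omega> \<in> space (P \<theta>1). ?d \<omega> = Some 0} \<le> \<gamma> * \<beta> + (1 - \<gamma>) * \<beta>"
  proof (rule error_bound[OF \<theta>(2) N(1)])
    let ?S = "\<lambda>n. {(y, z). y / real n + z / real n < - C n ((1 - \<gamma>) * \<beta>)}"
    show "(\<Sum>n. emeasure (DY \<Otimes>\<^sub>M DZ) (?S (Suc n))) \<le> ennreal ((1 - \<gamma>) * \<beta>)"
      using cond(2) split(1)[OF err(2)] by (simp only: noise_condition_b_def)
    show "?S n \<in> sets (borel \<Otimes>\<^sub>M borel)" for n by (rule sets_noise_exceeds)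
    fix \<omega> assume "\<omega> \<in> {\<omega> \<in> space (P \<theta>1). ?d \<omega> = Some 0}"
    then have "decision (threshold0 \<rho> \<theta>0 \<theta>1 C \<gamma> \<beta>) (threshold1 \<rho> \<theta>0 \<theta>1 C \<gamma> \<alpha>) X Y Z \<omega> = Some 0"
      unfolding dp_sprt_decision_def by blast
    from decision_0D[OF this] obtain n where n: "n \<ge> 1"
      and le: "sample_mean X n \<omega> + Y n \<omega> / real n \<le> threshold0 \<rho> \<theta>0 \<theta>1 C \<gamma> \<beta> n - Z \<omega> / real n"
      by blast
    have cancel: "real n * (u - v / real n) = real n * u - v"
      "real n * (u / real n * v) = v * u" for u v :: real
      using n by (auto simp: field_simps)
    \<comment> \<open>The parameters exchange roles: under \<theta>1 the relevant likelihood ratio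
      is that of \<theta>0 against \<theta>1, so a small sample mean makes it large.\<close>
    have "ln (1 / (\<gamma> * \<beta>)) \<le> (\<theta>0 - \<theta>1) * (\<Sum>i=1..n. X i \<omega>) - real n * (log_partition \<rho> \<theta>0 - log_partition \<rho> \<theta>1)"
      if "(Y n \<omega>, Z \<omega>) \<notin> ?S n"
    proof -
      have "sample_mean X n \<omega> \<le> (?B - ln (1 / (\<gamma> * \<beta>)) / real n) / (\<theta>1 - \<theta>0)"
        using that le unfolding threshold0_eq[OF \<theta>] mem_Collect_eq prod.case by linarith
      then have "(\<Sum>i=1..n. X i \<omega>) / real n * (\<theta>1 - \<theta>0) \<le> ?B - ln (1 / (\<gamma> * \<beta>)) / real n"
        using \<theta>(3) by (simp only: sample_mean_def pos_le_divide_eq diff_gt_0_iff_gt)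
      then have "real n * ((\<Sum>i=1..n. X i \<omega>) / real n * (\<theta>1 - \<theta>0))
          \<le> real n * (?B - ln (1 / (\<gamma> * \<beta>)) / real n)"
        by (rule mult_left_mono) simp
      then show ?thesis unfolding cancel by (simp add: algebra_simps)
    qed
    then show "\<exists>n\<ge>1. (Y n \<omega>, Z \<omega>) \<in> ?S n \<or>
        ln (1 / (\<gamma> * \<beta>)) \<le> (\<theta>0 - \<theta>1) * (\<Sum>i=1..n. X i \<omega>)
          - real n * (log_partition \<rho> \<theta>0 - log_partition \<rho> \<theta>1)"
      using n by blast
  qed (use split[OF err(2)] in auto)
  ultimately show ?thesis
    using split(2)[OF err(1)] split(2)[OF err(2)] by (simp add: correct_test_def)
qed

end

theorem theorem3:
  fixes \<rho> :: "real measure" and \<Theta> :: "real set"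
    and DY DZ :: "real measure"
    and P :: "real \<Rightarrow> 'a measure"
    and X Y :: "nat \<Rightarrow> 'a \<Rightarrow> real" and Z :: "'a \<Rightarrow> real"
    and C :: "nat \<Rightarrow> real \<Rightarrow> real"
    and \<theta>0 \<theta>1 \<alpha> \<beta> \<gamma> :: real
  assumes "dp_sprt_model \<rho> \<Theta> DY DZ P X Y Z"
    and "\<theta>0 \<in> \<Theta>" "\<theta>1 \<in> \<Theta>" "\<theta>0 < \<theta>1"
    and "\<alpha> \<in> {0<..<1}" "\<beta> \<in> {0<..<1}" "\<gamma> \<in> {0<..<1}"
  shows "(noise_condition_a DY DZ C \<and> noise_condition_b DY DZ C \<longrightarrow>
           correct_test P \<theta>0 \<theta>1 \<alpha> \<beta> (dp_sprt_decision \<rho> \<theta>0 \<theta>1 C \<gamma> \<alpha> \<beta> X Y Z))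
       \<and> (symmetric_around_zero DY \<and> noise_condition_a DY DZ C \<longrightarrow>
           noise_condition_b DY DZ C \<and>
           correct_test P \<theta>0 \<theta>1 \<alpha> \<beta> (dp_sprt_decision \<rho> \<theta>0 \<theta>1 C \<gamma> \<alpha> \<beta> X Y Z))"
proof -
  interpret dp_sprt_model \<rho> \<Theta> DY DZ P X Y Z by (rule assms(1))
  show ?thesis
    using correct_test_dp_sprt[OF assms(2-7), of C] noise_condition_b_if_symmetric[of C] by blast
qed

end
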